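(* Let $\gamma>0$, $\omega\in(0,1/2)$ and $\delta>0$. Let $\lambda_\delta(n)>0$, $n\in[1,\infty)$, be the eigenvalues of the operator $\mathcal{L}_\delta$ (as a function of a continuous variable $n$), such that $n\mapsto(\lambda_\delta(n))^{-1}$ is strictly decreasing and strictly convex, and let $\lambda_0(n)=n^2$. For $\sigma\in\{0,\delta\}$ let $$F(N;\sigma,\omega)=\sum_{m=1}^\infty\frac{1}{\lambda_\sigma(mN)}\left(\frac{\sin(m\pi\omega)}{m}\right)^2,\qquad \Delta_NF(N;\sigma,\omega)=F(N+1;\sigma,\omega)-F(N;\sigma,\omega),$$ let $N^*(\gamma,\sigma)$ be the largest minimizer over $N\in\mathbb{Z}^+$ of $2N+\frac{2\gamma}{\pi}F(N;\sigma,\omega)$, and let $$\Delta_\delta\Delta_NF(N;\delta,\omega)=\Delta_NF(N;\delta,\omega)-\Delta_NF(N;0,\omega).$$ Write $N^*=N^*(\gamma,\delta)$. (i) If $\Delta_\delta\Delta_NF(N^*-1;\delta,\omega)\le0$ and $\Delta_\delta\Delta_NF(N^*;\delta,\omega)\le0$, then $\delta$ cumulatively promotes the bubble splitting, namely $N^*(\gamma,\delta)\ge N^*(\gamma,0)$. (ii) If $\Delta_\delta\Delta_NF(N^*-1;\delta,\omega)\ge0$ and $\Delta_\delta\Delta_NF(N^*;\delta,\omega)\ge0$, then $\delta$ cumulatively demotes the bubble splitting, namely $N^*(\gamma,\delta)\le N^*(\gamma,0)$.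
   Context: The value $\delta=0$ corresponds to the local limit $\mathcal{L}_0=-\Delta$ with $2\pi$-periodic boundary conditions, whose eigenvalues are $\lambda_0(n)=n^2$. When $N^*=1$ the condition at $N^*-1=0$ is void and only the condition at $N^*$ is required. *)

theory Defs
  imports "HOL-Analysis.Analysis"
begin

definition strictly_convex_on :: "real set \<Rightarrow> (real \<Rightarrow> real) \<Rightarrow> bool" where
  "strictly_convex_on S f \<longleftrightarrow> convex S \<and>
     (\<forall>x\<in>S. \<forall>y\<in>S. \<forall>t. x \<noteq> y \<longrightarrow> 0 < t \<longrightarrow> t < 1 \<longrightarrow>
        f ((1 - t) * x + t * y) < (1 - t) * f x + t * f y)"

(* Operators are total HOL functions; values of L outside its intended domain are irrelevant
   as long as L has the expected action on one periodic eigenfunction. *)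
definition periodic_eigenvalue :: "((real \<Rightarrow> real) \<Rightarrow> real \<Rightarrow> real) \<Rightarrow> real \<Rightarrow> bool" where
  "periodic_eigenvalue L \<mu> \<longleftrightarrow>
     (\<exists>u. (\<forall>x. u (x + 2 * pi) = u x) \<and> (\<exists>x. u x \<noteq> 0) \<and> (\<forall>x. L u x = \<mu> * u x))"

(* lam sigma is the eigenvalue function of a continuous variable for the parameter sigma.
   The series index is shifted by one, since suminf starts at 0. *)
definition F :: "(real \<Rightarrow> real \<Rightarrow> real) \<Rightarrow> nat \<Rightarrow> real \<Rightarrow> real \<Rightarrow> real" where
  "F lam N \<sigma> \<omega> =
     (\<Sum>k. 1 / lam \<sigma> (real (Suc k) * real N) *
           (sin (real (Suc k) * pi * \<omega>) / real (Suc k)) ^ 2)"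

definition Delta_N_F :: "(real \<Rightarrow> real \<Rightarrow> real) \<Rightarrow> nat \<Rightarrow> real \<Rightarrow> real \<Rightarrow> real" where
  "Delta_N_F lam N \<sigma> \<omega> = F lam (N + 1) \<sigma> \<omega> - F lam N \<sigma> \<omega>"

definition Delta_delta_Delta_N_F ::
    "(real \<Rightarrow> real \<Rightarrow> real) \<Rightarrow> nat \<Rightarrow> real \<Rightarrow> real \<Rightarrow> real" where
  "Delta_delta_Delta_N_F lam N \<delta> \<omega> = Delta_N_F lam N \<delta> \<omega> - Delta_N_F lam N 0 \<omega>"

definition energy :: "(real \<Rightarrow> real \<Rightarrow> real) \<Rightarrow> real \<Rightarrow> real \<Rightarrow> real \<Rightarrow> nat \<Rightarrow> real" where
  "energy lam \<gamma> \<sigma> \<omega> N = 2 * real N + 2 * \<gamma> / pi * F lam N \<sigma> \<omega>"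

definition is_minimizer :: "(real \<Rightarrow> real \<Rightarrow> real) \<Rightarrow> real \<Rightarrow> real \<Rightarrow> real \<Rightarrow> nat \<Rightarrow> bool" where
  "is_minimizer lam \<gamma> \<sigma> \<omega> N \<longleftrightarrow>
     N \<ge> 1 \<and> (\<forall>M\<ge>1. energy lam \<gamma> \<sigma> \<omega> N \<le> energy lam \<gamma> \<sigma> \<omega> M)"

(* For lam sigma > 0 and gamma > 0 the energy is at least 2 * N, so minimizers exist and are
   bounded, and GREATEST is then the maximum. *)
definition N_star :: "(real \<Rightarrow> real \<Rightarrow> real) \<Rightarrow> real \<Rightarrow> real \<Rightarrow> real \<Rightarrow> nat" where
  "N_star lam \<gamma> \<sigma> \<omega> = (GREATEST N. is_minimizer lam \<gamma> \<sigma> \<omega> N)"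

end

theory Submission
  imports Defs
begin

text \<open>
  Convexity of \<open>1 / \<lambda>\<^sub>\<sigma>\<close> is inherited, term by term in the series, by \<open>N \<mapsto> F(N; \<sigma>, \<omega>)\<close>
  and hence by the energy \<open>2 N + (2 \<gamma> / \<pi>) F(N; \<sigma>, \<omega>)\<close>.  The increments of a convex sequence
  are monotone, so its descents (increment at most zero) all precede its ascents (increment positive).
  Since the energy is at least \<open>2 N\<close>, ascents occur, and the largest minimizer is exactly the
  position of the first ascent.  Thus any ascent at \<open>N\<close> bounds the largest minimizer from above by
  \<open>N\<close>, and any descent at \<open>N\<close> bounds it strictly from below by \<open>N\<close>.

  Both claims come from comparing the increments of the two energies at one point.  The energy for
  \<open>\<delta>\<close> ascends at \<open>N\<^sup>* = N\<^sup>*(\<gamma>, \<delta>)\<close>; if the increment of the local energy is no smaller there, it ascends too,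
  so \<open>N\<^sup>*(\<gamma>, 0) \<le> N\<^sup>*\<close>.  The energy for \<open>\<delta>\<close> descends at \<open>N\<^sup>* - 1\<close>; if the increment of the local
  energy is no larger there, it descends too, so \<open>N\<^sup>*(\<gamma>, 0) > N\<^sup>* - 1\<close>.  For \<open>N\<^sup>* = 1\<close> the
  latter conclusion is trivial.
\<close>

section \<open>The largest minimizer of a convex sequence\<close>

locale coercive_convex_sequence =
  fixes e :: "nat \<Rightarrow> real"
  assumes convex: "\<And>N. N \<ge> 1 \<Longrightarrow> 2 * e (N + 1) \<le> e N + e (N + 2)"
    and lower_bound: "\<And>N. N \<ge> 1 \<Longrightarrow> 2 * real N \<le> e N"
begin

definition minimizer :: "nat \<Rightarrow> bool" where
  "minimizer N \<longleftrightarrow> N \<ge> 1 \<and> (\<forall>M\<ge>1. e N \<le> e M)"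

definition largest_minimizer :: nat where
  "largest_minimizer = (GREATEST N. minimizer N)"

lemma increment_mono:
  assumes "1 \<le> M" "M \<le> N"
  shows "e (M + 1) - e M \<le> e (N + 1) - e N"
  using assms(2)
proof (induction N rule: dec_induct)
  case (step n)
  then show ?case using convex[of n] assms(1) by simp
qed simp

lemma minimizer_le:
  assumes "minimizer N"
  shows "N \<le> nat \<lceil>e 1\<rceil>"
proof -
  have "2 * real N \<le> e 1"
    using assms lower_bound[of N] by (force simp: minimizer_def)
  then show ?thesis by linarith
qed

text \<open>
  Beyond \<open>e 1\<close> the lower bound exceeds the value at 1, so only finitely many indices compete.
\<close>

lemma minimizer_exists: "\<exists>N. minimizer N"
proof -
  define K where "K = Suc (nat \<lceil>e 1\<rceil>)"
  obtain N where N: "N \<in> {1..K}" "\<And>M. M \<in> {1..K} \<Longrightarrow> e N \<le> e M"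
    using ex_min_if_finite[of "e ` {1..K}"] by (force simp: K_def not_less)
  have "e N \<le> e M" if "M \<ge> 1" for M
  proof (cases "M \<le> K")
    case True
    then show ?thesis using N that by auto
  next
    case False
    have "e N \<le> e 1" using N(2)[of 1] by (simp add: K_def)
    also have "\<dots> \<le> 2 * real M" using False unfolding K_def by linarith
    also have "\<dots> \<le> e M" using that by (rule lower_bound)
    finally show ?thesis .
  qed
  then show ?thesis using N(1) by (auto simp: minimizer_def)
qed

lemma minimizer_largest_minimizer: "minimizer largest_minimizer"
  unfolding largest_minimizer_def
  using minimizer_exists minimizer_le by (auto intro: GreatestI_nat)

lemma minimizer_le_largest_minimizer: "minimizer N \<Longrightarrow> N \<le> largest_minimizer"
  unfolding largest_minimizer_def
  using minimizer_le by (auto intro: Greatest_le_nat)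

text \<open>
  If the next value were not larger, the next index would be a minimizer as well.
\<close>

lemma ascent_at_largest_minimizer:
  "e largest_minimizer < e (largest_minimizer + 1)"
proof (rule ccontr)
  assume "\<not> ?thesis"
  then have "minimizer (largest_minimizer + 1)"
    using minimizer_largest_minimizer by (force simp: minimizer_def)
  then show False using minimizer_le_largest_minimizer by fastforce
qed

text \<open>
  A minimizer beyond an ascent would be preceded immediately by an ascent, by monotonicity of
  the increments, and so by a smaller value.
\<close>

lemma largest_minimizer_le_if_ascent:
  assumes "N \<ge> 1" "e N < e (N + 1)"
  shows "largest_minimizer \<le> N"
proof (rule ccontr)
  assume "\<not> ?thesis"
  then obtain M where M: "largest_minimizer = M + 1" "N \<le> M"
    by (cases largest_minimizer) auto
  have "e M < e (M + 1)" using increment_mono[of N M] assms M(2) by linarith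
  moreover have "e (M + 1) \<le> e M"
    using minimizer_largest_minimizer M assms(1) by (auto simp: minimizer_def)
  ultimately show False by simp
qed

lemma largest_minimizer_gt_if_descent:
  assumes "N \<ge> 1" "e (N + 1) \<le> e N"
  shows "N < largest_minimizer"
proof (rule ccontr)
  assume "\<not> ?thesis"
  moreover have "largest_minimizer \<ge> 1"
    using minimizer_largest_minimizer by (simp add: minimizer_def)
  ultimately have "e (largest_minimizer + 1) - e largest_minimizer \<le> e (N + 1) - e N"
    by (intro increment_mono) auto
  then show False using ascent_at_largest_minimizer assms(2) by linarith
qed

end

section \<open>Convexity of the energy\<close>

text \<open>
  The series converges because \<open>1 / \<lambda>\<^sub>\<sigma>\<close> is bounded and its weights are at most \<open>1 / m\<^sup>2\<close>.  Since
  \<open>m (N + 1)\<close> is the midpoint of \<open>m N\<close> and \<open>m (N + 2)\<close>, midpoint convexity of \<open>1 / \<lambda>\<^sub>\<sigma>\<close> makes each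
  term a convex sequence in \<open>N\<close>, and the sum inherits this.
\<close>

lemma coercive_convex_sequence_energy:
  fixes lam :: "real \<Rightarrow> real \<Rightarrow> real"
  assumes \<gamma>: "\<gamma> \<ge> 0"
    and nonneg: "\<And>x. x \<ge> 1 \<Longrightarrow> 0 \<le> 1 / lam \<sigma> x"
    and bounded: "\<And>x. x \<ge> 1 \<Longrightarrow> 1 / lam \<sigma> x \<le> B"
    and midpoint: "\<And>x y. \<lbrakk>x \<ge> 1; y \<ge> 1\<rbrakk> \<Longrightarrow>
      2 * (1 / lam \<sigma> ((x + y) / 2)) \<le> 1 / lam \<sigma> x + 1 / lam \<sigma> y"
  shows "coercive_convex_sequence (energy lam \<gamma> \<sigma> \<omega>)"
proof -
  define h where "h = (\<lambda>x. 1 / lam \<sigma> x)"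
  define w where "w = (\<lambda>k. (sin (real (Suc k) * pi * \<omega>) / real (Suc k)) ^ 2)"
  have F_eq: "F lam N \<sigma> \<omega> = (\<Sum>k. h (real (Suc k) * real N) * w k)" for N
    by (simp add: F_def h_def w_def)
  have ge1: "real (Suc k) * real N \<ge> 1" if "N \<ge> 1" for k N
    using mult_mono[of 1 "real (Suc k)" 1 "real N"] that by simp
  have w_nonneg: "w k \<ge> 0" for k by (simp add: w_def)
  have w_le: "w k \<le> 1 / real (Suc k) ^ 2" for k
    unfolding w_def power_divide
    by (intro divide_right_mono) (auto simp: abs_square_le_1)
  have w_summable: "summable w"
  proof (rule summable_comparison_test')
    have "summable (\<lambda>n. 1 / real n ^ 2)"
      using inverse_power_summable[of 2, where 'a = real] by (simp add: field_simps)
    then show "summable (\<lambda>k. 1 / real (Suc k) ^ 2)" by (subst summable_Suc_iff)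
    show "norm (w k) \<le> 1 / real (Suc k) ^ 2" if "k \<ge> 0" for k
      using w_le w_nonneg by simp
  qed
  have term_nonneg: "0 \<le> h (real (Suc k) * real N) * w k" if "N \<ge> 1" for k N
    using nonneg[OF ge1[OF that]] w_nonneg by (simp add: h_def)
  have summable: "summable (\<lambda>k. h (real (Suc k) * real N) * w k)" if "N \<ge> 1" for N
  proof (rule summable_comparison_test')
    show "summable (\<lambda>k. B * w k)" using w_summable by (rule summable_mult)
    show "norm (h (real (Suc k) * real N) * w k) \<le> B * w k" if "k \<ge> 0" for k
      using term_nonneg[OF \<open>N \<ge> 1\<close>] bounded[OF ge1[OF \<open>N \<ge> 1\<close>]] w_nonneg
      by (simp add: h_def mult_right_mono del: of_nat_Suc times_divide_eq_left)
  qed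
  have F_nonneg: "0 \<le> F lam N \<sigma> \<omega>" if "N \<ge> 1" for N
    unfolding F_eq using summable[OF that] term_nonneg[OF that] by (rule suminf_nonneg)
  have F_convex: "2 * F lam (N + 1) \<sigma> \<omega> \<le> F lam N \<sigma> \<omega> + F lam (N + 2) \<sigma> \<omega>"
    if "N \<ge> 1" for N
  proof -
    have term_convex: "2 * (h (real (Suc k) * real (N + 1)) * w k)
        \<le> h (real (Suc k) * real N) * w k + h (real (Suc k) * real (N + 2)) * w k" for k
    proof -
      have mid: "real (Suc k) * real (N + 1)
          = (real (Suc k) * real N + real (Suc k) * real (N + 2)) / 2"
        by (simp add: algebra_simps)
      have "2 * h (real (Suc k) * real (N + 1))
          \<le> h (real (Suc k) * real N) + h (real (Suc k) * real (N + 2))"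
        unfolding mid h_def by (intro midpoint ge1) (use that in auto)
      from mult_right_mono[OF this w_nonneg[of k]] show ?thesis
        by (simp only: distrib_right mult.assoc)
    qed
    have "2 * F lam (N + 1) \<sigma> \<omega> = (\<Sum>k. 2 * (h (real (Suc k) * real (N + 1)) * w k))"
      unfolding F_eq by (intro suminf_mult[symmetric] summable) simp
    also have "\<dots> \<le> (\<Sum>k. h (real (Suc k) * real N) * w k
        + h (real (Suc k) * real (N + 2)) * w k)"
      using that
      by (intro suminf_le term_convex summable_add summable_mult summable) auto
    also have "\<dots> = F lam N \<sigma> \<omega> + F lam (N + 2) \<sigma> \<omega>"
      unfolding F_eq using that by (intro suminf_add[symmetric] summable) auto
    finally show ?thesis .
  qed
  define c where "c = 2 * \<gamma> / pi"
  have c: "c \<ge> 0" using \<gamma> by (simp add: c_def)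
  have energy_eq: "energy lam \<gamma> \<sigma> \<omega> N = 2 * real N + c * F lam N \<sigma> \<omega>" for N
    by (simp add: energy_def c_def)
  show ?thesis
  proof
    fix N :: nat assume N: "N \<ge> 1"
    have "c * (2 * F lam (N + 1) \<sigma> \<omega>) \<le> c * (F lam N \<sigma> \<omega> + F lam (N + 2) \<sigma> \<omega>)"
      using F_convex[OF N] c by (rule mult_left_mono)
    then show "2 * energy lam \<gamma> \<sigma> \<omega> (N + 1) \<le> energy lam \<gamma> \<sigma> \<omega> N + energy lam \<gamma> \<sigma> \<omega> (N + 2)"
      by (simp add: energy_eq algebra_simps)
    show "2 * real N \<le> energy lam \<gamma> \<sigma> \<omega> N"
      using F_nonneg[OF N] c by (simp add: energy_eq)
  qed
qed

lemma N_star_eq_largest_minimizer: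
  assumes "coercive_convex_sequence (energy lam \<gamma> \<sigma> \<omega>)"
  shows "N_star lam \<gamma> \<sigma> \<omega> = coercive_convex_sequence.largest_minimizer (energy lam \<gamma> \<sigma> \<omega>)"
  unfolding N_star_def is_minimizer_def
    coercive_convex_sequence.largest_minimizer_def[OF assms]
    coercive_convex_sequence.minimizer_def[OF assms] ..

text \<open>
  Two applications of the inequality between arithmetic and geometric means:
  \<open>1 / x\<^sup>2 + 1 / y\<^sup>2 \<ge> 2 / (x y) \<ge> 2 / ((x + y) / 2)\<^sup>2\<close>.
\<close>

lemma inverse_square_midpoint_convex:
  fixes x y :: real
  assumes "x > 0" "y > 0"
  shows "2 * (1 / ((x + y) / 2) ^ 2) \<le> 1 / x ^ 2 + 1 / y ^ 2"
proof -
  have "x * y \<le> ((x + y) / 2) ^ 2"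
    using zero_le_power2[of "x - y"] by (simp add: power2_eq_square field_simps)
  then have "1 / ((x + y) / 2) ^ 2 \<le> 1 / (x * y)"
    using assms by (intro divide_left_mono) auto
  moreover have "2 * (1 / (x * y)) \<le> 1 / x ^ 2 + 1 / y ^ 2"
    using zero_le_power2[of "1 / x - 1 / y"] by (simp add: power2_eq_square algebra_simps)
  ultimately show ?thesis by linarith
qed

lemma strictly_convex_on_midpoint:
  assumes "strictly_convex_on S f" "x \<in> S" "y \<in> S"
  shows "2 * f ((x + y) / 2) \<le> f x + f y"
proof (cases "x = y")
  case False
  have "0 < t \<longrightarrow> t < 1 \<longrightarrow> f ((1 - t) * x + t * y) < (1 - t) * f x + t * f y" for t
    using assms False unfolding strictly_convex_on_def by blast
  from this[of "1 / 2"] have "f ((1 - 1 / 2) * x + 1 / 2 * y) < (1 - 1 / 2) * f x + 1 / 2 * f y"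
    by simp
  then show ?thesis by (simp add: field_simps)
qed simp

section \<open>Comparison with the local limit\<close>

lemma energy_increment_difference:
  "(energy lam \<gamma> \<delta> \<omega> (N + 1) - energy lam \<gamma> \<delta> \<omega> N)
    - (energy lam \<gamma> 0 \<omega> (N + 1) - energy lam \<gamma> 0 \<omega> N)
    = 2 * \<gamma> / pi * Delta_delta_Delta_N_F lam N \<delta> \<omega>"
  by (simp add: energy_def Delta_delta_Delta_N_F_def Delta_N_F_def field_simps)

theorem theorem3p5:
  fixes \<gamma> \<omega> \<delta> :: real
    and L :: "(real \<Rightarrow> real) \<Rightarrow> real \<Rightarrow> real"
    and lam :: "real \<Rightarrow> real \<Rightarrow> real"
  assumes gamma_pos: "\<gamma> > 0"
    and omega: "0 < \<omega>" "\<omega> < 1 / 2"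
    and delta_pos: "\<delta> > 0"
    and lam_eigenvalue: "\<And>n::nat. n \<ge> 1 \<Longrightarrow> periodic_eigenvalue L (lam \<delta> (real n))"
    and lam_pos: "\<And>n::real. n \<ge> 1 \<Longrightarrow> lam \<delta> n > 0"
    and lam_inv_decreasing: "strict_antimono_on {1..} (\<lambda>n. 1 / lam \<delta> n)"
    and lam_inv_convex: "strictly_convex_on {1..} (\<lambda>n. 1 / lam \<delta> n)"
    and lam_local: "\<And>n::real. n \<ge> 1 \<Longrightarrow> lam 0 n = n ^ 2"
  shows "((N_star lam \<gamma> \<delta> \<omega> > 1 \<longrightarrow>
             Delta_delta_Delta_N_F lam (N_star lam \<gamma> \<delta> \<omega> - 1) \<delta> \<omega> \<le> 0) \<and>
          Delta_delta_Delta_N_F lam (N_star lam \<gamma> \<delta> \<omega>) \<delta> \<omega> \<le> 0 \<longrightarrow>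
            N_star lam \<gamma> \<delta> \<omega> \<ge> N_star lam \<gamma> 0 \<omega>) \<and>
         ((N_star lam \<gamma> \<delta> \<omega> > 1 \<longrightarrow>
             Delta_delta_Delta_N_F lam (N_star lam \<gamma> \<delta> \<omega> - 1) \<delta> \<omega> \<ge> 0) \<and>
          Delta_delta_Delta_N_F lam (N_star lam \<gamma> \<delta> \<omega>) \<delta> \<omega> \<ge> 0 \<longrightarrow>
            N_star lam \<gamma> \<delta> \<omega> \<le> N_star lam \<gamma> 0 \<omega>)"
proof -
  let ?e = "energy lam \<gamma> \<delta> \<omega>" and ?e_loc = "energy lam \<gamma> 0 \<omega>"
  let ?N = "N_star lam \<gamma> \<delta> \<omega>" and ?N_loc = "N_star lam \<gamma> 0 \<omega>"
  have seq: "coercive_convex_sequence ?e"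
  proof (rule coercive_convex_sequence_energy)
    show "1 / lam \<delta> x \<le> 1 / lam \<delta> 1" if "x \<ge> 1" for x
      using lam_inv_decreasing that
      by (cases "x = 1") (fastforce simp: monotone_on_def intro: less_imp_le)+
    show "0 \<le> 1 / lam \<delta> x" if "x \<ge> 1" for x
      using lam_pos[OF that] by simp
    show "2 * (1 / lam \<delta> ((x + y) / 2)) \<le> 1 / lam \<delta> x + 1 / lam \<delta> y" if "x \<ge> 1" "y \<ge> 1" for x y
      using strictly_convex_on_midpoint[OF lam_inv_convex] that by simp
  qed (use gamma_pos in simp)
  have seq0: "coercive_convex_sequence ?e_loc"
  proof (rule coercive_convex_sequence_energy)
    show "1 / lam 0 x \<le> 1" if "x \<ge> 1" for x
      using that by (simp add: lam_local)
    show "2 * (1 / lam 0 ((x + y) / 2)) \<le> 1 / lam 0 x + 1 / lam 0 y" if "x \<ge> 1" "y \<ge> 1" for x y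
      using that inverse_square_midpoint_convex[of x y] by (simp add: lam_local)
  qed (use gamma_pos in \<open>auto simp: lam_local\<close>)
  interpret d: coercive_convex_sequence ?e by (rule seq)
  interpret l: coercive_convex_sequence ?e_loc by (rule seq0)
  have N: "?N = d.largest_minimizer" and N0: "?N_loc = l.largest_minimizer"
    using seq seq0 by (simp_all add: N_star_eq_largest_minimizer)
  have min: "d.minimizer ?N" and min0: "l.minimizer ?N_loc"
    using N N0 d.minimizer_largest_minimizer l.minimizer_largest_minimizer by simp_all
  have c: "2 * \<gamma> / pi \<ge> 0" using gamma_pos by simp
  have promote: "?N_loc \<le> ?N" if "Delta_delta_Delta_N_F lam ?N \<delta> \<omega> \<le> 0"
  proof -
    have "?e (?N + 1) - ?e ?N \<le> ?e_loc (?N + 1) - ?e_loc ?N"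
      using energy_increment_difference[of lam \<gamma> \<delta> \<omega> ?N] mult_nonneg_nonpos[OF c that]
      by linarith
    moreover have "?e ?N < ?e (?N + 1)"
      unfolding N by (rule d.ascent_at_largest_minimizer)
    ultimately have "?e_loc ?N < ?e_loc (?N + 1)" by linarith
    with min show ?thesis
      unfolding N0 by (intro l.largest_minimizer_le_if_ascent) (auto simp: d.minimizer_def)
  qed
  have demote: "?N \<le> ?N_loc" if "?N > 1 \<longrightarrow> Delta_delta_Delta_N_F lam (?N - 1) \<delta> \<omega> \<ge> 0"
  proof (cases "?N > 1")
    case True
    then obtain M where M: "?N = M + 1" "M \<ge> 1"
      by (cases ?N) auto
    have "?e_loc (M + 1) - ?e_loc M \<le> ?e (M + 1) - ?e M"
      using energy_increment_difference[of lam \<gamma> \<delta> \<omega> M] mult_nonneg_nonneg[OF c] that True M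
      by fastforce
    moreover have "?e (M + 1) \<le> ?e M"
      using min M by (simp add: d.minimizer_def)
    ultimately have "M < ?N_loc"
      unfolding N0 using M by (intro l.largest_minimizer_gt_if_descent) auto
    then show ?thesis using M by simp
  next
    case False
    then show ?thesis using min0 by (simp add: l.minimizer_def)
  qed
  show ?thesis using promote demote by blast
qed

end
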